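(* Assume $N_1\ge N_2\ge N_3$ and $T\ge \frac12\left(\sqrt{N_1^2-4N_3(N_2-N_3)}+N_1+2N_2-2\right)$. Then for every rational $R_1\in[0,C(T-N_3,N_1)]$ the rate pair $(R_1,R_2)$ with $$R_2=\min\Big(C(T-N_3,N_2),\;C(T-N_2,N_3)-C(T-N_3,N_1),\;R_2'\Big),\qquad R_2'=\frac{N_2}{N_1}\left[\frac{N_1}{N_2}-1-R_1+\frac{T+1-N_1-N_3}{T+1-N_2}\right],$$ is achievable, where $C(T,N)=\frac{T+1-N}{T+1}$.
   Context: Network: two sources, one relay, one destination; no direct source–destination link. Source $i\in\{1,2\}$ has messages $s_{t,i}\in\mathbb{F}^{k_i}$, $t\ge0$, over a finite field $\mathbb{F}$. A time-invariant $(n_1,n_2,n_3,k_1,k_2,T)_{\mathbb{F}}$ streaming code (unbounded memory): source $i$ sends at time $t$ a packet $x^{(1)}_{t,i}\in\mathbb{F}^{n_i}$, a fixed function of $s_{0,i},\dots,s_{t,i}$; a relay function $g$, the same at every time $t$, takes the packets received from both sources at times $t-T,\dots,t$ together with the relay's previously produced estimates of past source messages, and outputs a packet $x^{(2)}_t\in\mathbb{F}^{n_3}$ and estimates of $s_{t-T,1},s_{t-T,2}$; the destination outputs at time $t+T$ estimates $\hat s_{t,i}$ from its received packets up to time $t+T$. Each link is a packet erasure channel (received packet is the sent one or the erasure symbol $*$). An $N$-erasure sequence has exactly $N$ erased times; link source $i\to$relay suffers an arbitrary $N_i$-erasure sequence, relay$\to$destination an arbitrary $N_3$-erasure sequence.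 The code is $(N_1,N_2,N_3)$-achievable if $\hat s_{t,i}=s_{t,i}$ always. Rate pair: $R_i=k_i/n$, $n=\max(n_1,n_2,n_3)$; a rate pair is achievable if it is the rate pair of some $(N_1,N_2,N_3)$-achievable code (over some finite field). *)

theory Defs
  imports Complex_Main "HOL-Algebra.Ring"
begin

text \<open>Field elements are represented by natural numbers (every finite field is
isomorphic to one whose carrier is a subset of nat). A vector in F^k is a list of
length k with entries in the carrier. An erased packet is None.\<close>

type_synonym vec = "nat list"

definition vecs :: "nat ring \<Rightarrow> nat \<Rightarrow> vec set" where
  "vecs F k = {v. length v = k \<and> set v \<subseteq> carrier F}"

definition erase :: "nat set \<Rightarrow> (nat \<Rightarrow> 'a) \<Rightarrow> nat \<Rightarrow> 'a option" where
  "erase E x t = (if t \<in> E then None else Some (x t))"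

definition src_packet :: "(vec list \<Rightarrow> vec) \<Rightarrow> (nat \<Rightarrow> vec) \<Rightarrow> nat \<Rightarrow> vec" where
  "src_packet f s t = f (map s [0..<Suc t])"

text \<open>Received packets at times t-T,...,t (times below 0 omitted).\<close>
definition window :: "nat \<Rightarrow> (nat \<Rightarrow> 'a) \<Rightarrow> nat \<Rightarrow> 'a list" where
  "window T y t = map y [t - T..<Suc t]"

type_synonym relay_fun =
  "vec option list \<Rightarrow> vec option list \<Rightarrow> (vec \<times> vec) list \<Rightarrow> vec \<times> vec \<times> vec"

text \<open>Relay estimates of s_0,...,s_{t-T-1} available before time t
  (the estimate of s_{j} is produced at time j+T).\<close>
primrec relay_hist ::
  "nat \<Rightarrow> relay_fun \<Rightarrow> (nat \<Rightarrow> vec option) \<Rightarrow> (nat \<Rightarrow> vec option) \<Rightarrow> nat \<Rightarrow> (vec \<times> vec) list" where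
  "relay_hist T g y1 y2 0 = []"
| "relay_hist T g y1 y2 (Suc t) = relay_hist T g y1 y2 t @
     (if T \<le> t then [snd (g (window T y1 t) (window T y2 t) (relay_hist T g y1 y2 t))] else [])"

definition relay_packet ::
  "nat \<Rightarrow> relay_fun \<Rightarrow> (nat \<Rightarrow> vec option) \<Rightarrow> (nat \<Rightarrow> vec option) \<Rightarrow> nat \<Rightarrow> vec" where
  "relay_packet T g y1 y2 t = fst (g (window T y1 t) (window T y2 t) (relay_hist T g y1 y2 t))"

definition code_wf ::
  "nat ring \<Rightarrow> nat \<Rightarrow> nat \<Rightarrow> nat \<Rightarrow> nat \<Rightarrow> nat \<Rightarrow>
   (vec list \<Rightarrow> vec) \<Rightarrow> (vec list \<Rightarrow> vec) \<Rightarrow> relay_fun \<Rightarrow> bool" where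
  "code_wf F n1 n2 n3 k1 k2 f1 f2 g \<longleftrightarrow>
     (\<forall>ms. set ms \<subseteq> vecs F k1 \<longrightarrow> f1 ms \<in> vecs F n1) \<and>
     (\<forall>ms. set ms \<subseteq> vecs F k2 \<longrightarrow> f2 ms \<in> vecs F n2) \<and>
     (\<forall>a b c. fst (g a b c) \<in> vecs F n3 \<and> fst (snd (g a b c)) \<in> vecs F k1
              \<and> snd (snd (g a b c)) \<in> vecs F k2)"

definition code_achieves ::
  "nat ring \<Rightarrow> nat \<Rightarrow> nat \<Rightarrow> nat \<Rightarrow> nat \<Rightarrow> nat \<Rightarrow> nat \<Rightarrow>
   (vec list \<Rightarrow> vec) \<Rightarrow> (vec list \<Rightarrow> vec) \<Rightarrow> relay_fun \<Rightarrow> (vec option list \<Rightarrow> vec \<times> vec) \<Rightarrow> bool" where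
  "code_achieves F k1 k2 T N1 N2 N3 f1 f2 g d \<longleftrightarrow>
     (\<forall>s1 s2 E1 E2 E3.
        (\<forall>t. s1 t \<in> vecs F k1) \<longrightarrow> (\<forall>t. s2 t \<in> vecs F k2) \<longrightarrow>
        finite E1 \<longrightarrow> card E1 = N1 \<longrightarrow> finite E2 \<longrightarrow> card E2 = N2 \<longrightarrow>
        finite E3 \<longrightarrow> card E3 = N3 \<longrightarrow>
        (let y1 = erase E1 (src_packet f1 s1);
             y2 = erase E2 (src_packet f2 s2);
             y3 = erase E3 (relay_packet T g y1 y2)
         in \<forall>t. d (map y3 [0..<Suc (t + T)]) = (s1 t, s2 t)))"

definition rate_pair_achievable :: "nat \<Rightarrow> nat \<Rightarrow> nat \<Rightarrow> nat \<Rightarrow> real \<Rightarrow> real \<Rightarrow> bool" where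
  "rate_pair_achievable N1 N2 N3 T R1 R2 \<longleftrightarrow>
     (\<exists>(F :: nat ring) n1 n2 n3 k1 k2 f1 f2 g d.
        field F \<and> finite (carrier F) \<and>
        code_wf F n1 n2 n3 k1 k2 f1 f2 g \<and>
        code_achieves F k1 k2 T N1 N2 N3 f1 f2 g d \<and>
        0 < max n1 (max n2 n3) \<and>
        R1 = real k1 / real (max n1 (max n2 n3)) \<and>
        R2 = real k2 / real (max n1 (max n2 n3)))"

definition capC :: "real \<Rightarrow> real \<Rightarrow> real" where
  "capC T N = (T + 1 - N) / (T + 1)"

end

theory Submission
  imports Defs "HOL-Computational_Algebra.Polynomial" "HOL-Number_Theory.Cong"
begin

text \<open>Put \<open>w = T + 1 - N\<^sub>3\<close> and \<open>v = T + 1 - N\<^sub>2\<close>. A source that protects a stream by a diagonally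
interleaved systematic MDS code of length \<open>m\<close> against \<open>N\<close> erasures delivers to the relay one symbol
with each of the delays \<open>N, \<dots>, m - 1\<close>. A relay code of length \<open>v\<close> against \<open>N\<^sub>3\<close> erasures, applied to
symbols of one source time, has room for one symbol with each of the delays \<open>N\<^sub>2, \<dots>, w - 1\<close>. This is
filled exactly by a stream of length \<open>w\<close> of source 2, and also by a stream of length \<open>w\<close> of source 1
(delays \<open>N\<^sub>1, \<dots>, w - 1\<close>) together with a stream of length \<open>N\<^sub>1\<close> of source 2 (delays
\<open>N\<^sub>2, \<dots>, N\<^sub>1 - 1\<close>). What the relay sends is thus a function of the messages alone, not of the
erasures. Time sharing between the two ways of filling relay codewords gives the rate region.\<close>

section \<open>Systematic MDS codes over a prime field\<close>

text \<open>Root counting modulo \<open>p\<close> carried out with integer polynomials: synthetic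
  division at a root splits off a linear factor, and primality of \<open>p\<close> passes the
  remaining roots on to the quotient.\<close>

lemma prime_dvd_poly_if_many_roots:
  fixes P :: "int poly" and X :: "nat set"
  assumes "prime p" "finite X" "X \<subseteq> {..<p}" "P = 0 \<or> degree P < card X"
    and "\<And>x. x \<in> X \<Longrightarrow> int p dvd poly P (int x)"
  shows "int p dvd poly P y"
  using assms(2-5)
proof (induction X arbitrary: P rule: finite_induct)
  case empty
  then show ?case by simp
next
  case (insert a X)
  define Q where "Q = synthetic_div P (int a)"
  have P: "P = [:- int a, 1:] * Q + [:poly P (int a):]"
    unfolding Q_def by (rule synthetic_div_correct'[symmetric])
  have evalP: "poly P x = (x - int a) * poly Q x + poly P (int a)" for x
    by (subst P) (simp add: algebra_simps)
  have a: "int p dvd poly P (int a)"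
    using insert.prems(3) by simp
  have "int p dvd poly Q y"
  proof (rule insert.IH)
    show "X \<subseteq> {..<p}" using insert.prems(1) by simp
    show "Q = 0 \<or> degree Q < card X"
      using insert.prems(2) insert.hyps unfolding Q_def
      by (auto simp: degree_synthetic_div synthetic_div_eq_0_iff)
    fix x assume x: "x \<in> X"
    have "int p dvd (int x - int a) * poly Q (int x)"
      using insert.prems(3)[of x] a x by (simp add: evalP[of "int x"] dvd_add_left_iff)
    moreover have "\<not> int p dvd int x - int a"
    proof
      assume "int p dvd int x - int a"
      then have "[int x = int a] (mod int p)" by (simp add: cong_iff_dvd_diff)
      then have "[x = a] (mod p)" by (simp add: cong_int_iff)
      moreover have "x < p" "a < p" using x insert.prems(1) by auto
      ultimately have "x = a" by (simp add: cong_def)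
      then show False using x insert.hyps by simp
    qed
    ultimately show "int p dvd poly Q (int x)"
      using assms(1) prime_dvd_mult_iff[of "int p"] by auto
  qed
  then show ?case using a by (simp add: evalP[of y])
qed

text \<open>Newton interpolation: the new value is met by adding a multiple of \<open>W\<close>,
  which vanishes at the earlier nodes. All nodes lie below \<open>p\<close>, so the factors of
  \<open>W\<close> at the new node are units modulo \<open>p\<close>.\<close>

lemma interpolating_poly_mod_prime:
  assumes "prime p" "k \<le> p"
  shows "\<exists>P :: int poly. (P = 0 \<or> degree P < k) \<and>
           (\<forall>i<k. [poly P (int i) = int (m i)] (mod int p))"
  using assms(2)
proof (induction k)
  case 0
  then show ?case by auto
next
  case (Suc k)
  then obtain P :: "int poly" where P: "P = 0 \<or> degree P < k"
    "\<And>i. i < k \<Longrightarrow> [poly P (int i) = int (m i)] (mod int p)"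
    by auto
  define W where "W = (\<Prod>i<k. [:- int i, 1:])"
  have degW: "degree W \<le> k"
    unfolding W_def using degree_prod_sum_le[of "{..<k}" "\<lambda>i. [:- int i, 1:]"] by simp
  have W: "poly W x = (\<Prod>i<k. x - int i)" for x
    unfolding W_def by (simp add: poly_prod)
  have "coprime (int k - int i) (int p)" if "i < k" for i
  proof -
    have "\<not> p dvd k - i" using that Suc.prems by (auto dest: dvd_imp_le)
    then have "coprime p (k - i)" using assms(1) prime_imp_coprime by blast
    then have "coprime (int p) (int (k - i))" by simp
    then show ?thesis using that by (simp add: of_nat_diff coprime_commute)
  qed
  then have "coprime (poly W (int k)) (int p)"
    unfolding W by (intro prod_coprime_left) auto
  then obtain z where z: "[poly W (int k) * z = 1] (mod int p)"
    using cong_solve_coprime_int by blast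
  define R where "R = P + smult (z * (int (m k) - poly P (int k))) W"
  have "degree R \<le> k" unfolding R_def
    using P(1) degW by (intro degree_add_le order.trans[OF degree_smult_le]) auto
  moreover have "[poly R (int i) = int (m i)] (mod int p)" if "i < Suc k" for i
  proof (cases "i = k")
    case True
    have "[poly P (int k) + poly W (int k) * z * (int (m k) - poly P (int k))
        = poly P (int k) + 1 * (int (m k) - poly P (int k))] (mod int p)"
      by (intro cong_add cong_mult z cong_refl)
    then show ?thesis using True by (simp add: R_def algebra_simps)
  next
    case False
    then have "i < k" using that by simp
    moreover from this have "poly W (int i) = 0" by (auto simp: W)
    ultimately show ?thesis using P(2) by (simp add: R_def)
  qed
  ultimately show ?case by (intro exI[of _ R]) auto
qed

definition interpolating_poly :: "nat \<Rightarrow> nat \<Rightarrow> (nat \<Rightarrow> nat) \<Rightarrow> int poly" where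
  "interpolating_poly p k m = (SOME P. (P = 0 \<or> degree P < k) \<and>
     (\<forall>i<k. [poly P (int i) = int (m i)] (mod int p)))"

text \<open>A Reed-Solomon code in systematic form: the message prescribes the values at the first
  \<open>k\<close> evaluation points rather than the coefficients.\<close>

definition rs_code :: "nat \<Rightarrow> nat \<Rightarrow> (nat \<Rightarrow> nat) \<Rightarrow> nat \<Rightarrow> nat" where
  "rs_code p k m x = nat (poly (interpolating_poly p k m) (int x) mod int p)"

lemma rs_code_less: "0 < p \<Longrightarrow> rs_code p k m x < p"
  by (simp add: rs_code_def nat_less_iff)

text \<open>The predicate under \<open>SOME\<close> sees \<open>m\<close> only below
  \<open>k\<close>, so the same polynomial is chosen for both messages.\<close>

lemma rs_code_cong:
  assumes "\<And>i. i < k \<Longrightarrow> m i = m' i"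
  shows "rs_code p k m = rs_code p k m'"
proof -
  have "interpolating_poly p k m = interpolating_poly p k m'"
    unfolding interpolating_poly_def using assms by (intro arg_cong[of _ _ Eps]) auto
  then show ?thesis unfolding rs_code_def by auto
qed

lemma interpolating_poly:
  assumes "prime p" "k \<le> p"
  shows "interpolating_poly p k m = 0 \<or> degree (interpolating_poly p k m) < k"
    and "i < k \<Longrightarrow> [poly (interpolating_poly p k m) (int i) = int (m i)] (mod int p)"
  using someI_ex[OF interpolating_poly_mod_prime[OF assms, of m]]
  unfolding interpolating_poly_def by auto

lemma rs_code_systematic:
  assumes "prime p" "k \<le> p" "i < k" "m i < p"
  shows "rs_code p k m i = m i"
  using interpolating_poly(2)[OF assms(1-3), of m] assms(4)
  by (simp add: rs_code_def cong_def)

text \<open>Erasure decoding stated as injectivity: the difference of the interpolants has degree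
  below \<open>k\<close> and at least \<open>k\<close> roots modulo \<open>p\<close>, so it vanishes
  modulo \<open>p\<close> at the systematic positions too.\<close>

lemma rs_code_mds:
  assumes "prime p" "k \<le> p" "X \<subseteq> {..<p}" "k \<le> card X"
    and agree: "\<And>x. x \<in> X \<Longrightarrow> rs_code p k m x = rs_code p k m' x"
    and "i < k" "m i < p" "m' i < p"
  shows "m i = m' i"
proof -
  define P where "P = interpolating_poly p k m"
  define P' where "P' = interpolating_poly p k m'"
  have p: "0 < p" using assms(1) prime_gt_0_nat by blast
  have "int p dvd poly (P - P') (int i)"
  proof (rule prime_dvd_poly_if_many_roots[OF assms(1) _ assms(3)])
    show "finite X" using assms(3) finite_subset by blast
    show "P - P' = 0 \<or> degree (P - P') < card X"
      using interpolating_poly(1)[OF assms(1,2), of m] interpolating_poly(1)[OF assms(1,2), of m']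
        assms(4,6) degree_diff_less[of P k P'] unfolding P_def P'_def
      by (cases "interpolating_poly p k m = 0"; cases "interpolating_poly p k m' = 0") auto
    fix x assume "x \<in> X"
    from agree[OF this] have "poly P (int x) mod int p = poly P' (int x) mod int p"
      using p unfolding rs_code_def P_def P'_def by (simp add: eq_nat_nat_iff)
    then show "int p dvd poly (P - P') (int x)"
      by (simp add: mod_eq_dvd_iff)
  qed
  then have "poly P (int i) mod int p = poly P' (int i) mod int p"
    by (simp add: mod_eq_dvd_iff)
  then have "rs_code p k m i = rs_code p k m' i"
    by (simp add: rs_code_def P_def P'_def)
  then show ?thesis using rs_code_systematic assms by metis
qed

section \<open>The field of residues modulo a prime, on natural numbers\<close>

definition prime_field :: "nat \<Rightarrow> nat ring" where
  "prime_field p = \<lparr>carrier = {..<p}, monoid.mult = (\<lambda>a b. a * b mod p), one = 1,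
     zero = 0, add = (\<lambda>a b. (a + b) mod p)\<rparr>"

lemma carrier_prime_field [simp]: "carrier (prime_field p) = {..<p}"
  by (simp add: prime_field_def)

lemma field_prime_field:
  assumes "prime p"
  shows "field (prime_field p)"
proof -
  have p: "1 < p" using assms prime_gt_1_nat by blast
  have "cring (prime_field p)"
  proof (rule cringI)
    show "abelian_group (prime_field p)"
    proof (rule abelian_groupI)
      fix x assume "x \<in> carrier (prime_field p)"
      then show "\<exists>y\<in>carrier (prime_field p). y \<oplus>\<^bsub>prime_field p\<^esub> x = \<zero>\<^bsub>prime_field p\<^esub>"
        by (intro bexI[of _ "(p - x) mod p"]) (use p in \<open>auto simp: prime_field_def mod_simps\<close>)
    qed (use p in \<open>auto simp: prime_field_def mod_simps add_ac\<close>)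
    show "Group.comm_monoid (prime_field p)"
      by (rule Group.comm_monoidI) (use p in \<open>auto simp: prime_field_def mod_simps mult_ac\<close>)
  qed (auto simp: prime_field_def mod_simps algebra_simps)
  then interpret cring "prime_field p" .
  show ?thesis
  proof (rule cring_fieldI2)
    show "\<zero>\<^bsub>prime_field p\<^esub> \<noteq> \<one>\<^bsub>prime_field p\<^esub>" by (simp add: prime_field_def)
    fix a assume a: "a \<in> carrier (prime_field p)" "a \<noteq> \<zero>\<^bsub>prime_field p\<^esub>"
    then have "\<not> p dvd a" by (auto simp: prime_field_def dest: dvd_imp_le)
    then have "coprime a p" using assms prime_imp_coprime coprime_commute by blast
    then obtain x where "[a * x = 1] (mod p)" using cong_solve_coprime_nat by auto
    then show "\<exists>b\<in>carrier (prime_field p). a \<otimes>\<^bsub>prime_field p\<^esub> b = \<one>\<^bsub>prime_field p\<^esub>"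
      using p by (intro bexI[of _ "x mod p"]) (auto simp: prime_field_def cong_def mod_simps)
  qed
qed

section \<open>Codes from determinacy\<close>

text \<open>Turns determinacy into a decoder by picking any preimage of the observed data. The
  default \<open>v\<close> covers data that never occur, since \<open>code_wf\<close> restricts the
  relay outputs on every input.\<close>

lemma factor_through:
  assumes "\<And>\<sigma> \<sigma>'. \<sigma> \<in> S \<Longrightarrow> \<sigma>' \<in> S \<Longrightarrow> In \<sigma> = In \<sigma>' \<Longrightarrow> Out \<sigma> = Out \<sigma>'"
    and "Out ` S \<subseteq> V" "v \<in> V"
  obtains h where "\<And>\<sigma>. \<sigma> \<in> S \<Longrightarrow> h (In \<sigma>) = Out \<sigma>" "range h \<subseteq> V"
proof
  define h where "h z = (if z \<in> In ` S then Out (inv_into S In z) else v)" for z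
  show "h (In \<sigma>) = Out \<sigma>" if "\<sigma> \<in> S" for \<sigma>
    using assms(1)[of "inv_into S In (In \<sigma>)" \<sigma>] that
    by (simp add: h_def f_inv_into_f inv_into_into)
  show "range h \<subseteq> V"
    using assms(2,3) by (auto simp: h_def inv_into_into)
qed

text \<open>Decoders come for free once the data they see determine what they must output. The relay
may be assumed to know all messages older than its window, since its earlier estimates of these
were correct.\<close>
lemma code_exists_if_determined:
  fixes F :: "nat ring" and k1 k2 :: nat and X :: "(nat \<Rightarrow> vec) \<Rightarrow> (nat \<Rightarrow> vec) \<Rightarrow> nat \<Rightarrow> vec"
  defines "A1 \<equiv> {s. \<forall>t. s t \<in> vecs F k1}" and "A2 \<equiv> {s. \<forall>t. s t \<in> vecs F k2}"
  defines "\<E> N \<equiv> {E. finite E \<and> card E = N}"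
  assumes f1: "\<And>ms. set ms \<subseteq> vecs F k1 \<Longrightarrow> f1 ms \<in> vecs F n1"
    and f2: "\<And>ms. set ms \<subseteq> vecs F k2 \<Longrightarrow> f2 ms \<in> vecs F n2"
    and X: "\<And>s1 s2 t. s1 \<in> A1 \<Longrightarrow> s2 \<in> A2 \<Longrightarrow> X s1 s2 t \<in> vecs F n3"
    and relay: "\<And>s1 s2 s1' s2' E1 E2 E1' E2' t.
      \<lbrakk>s1 \<in> A1; s2 \<in> A2; s1' \<in> A1; s2' \<in> A2;
       E1 \<in> \<E> N1; E2 \<in> \<E> N2; E1' \<in> \<E> N1; E2' \<in> \<E> N2;
       window T (erase E1 (src_packet f1 s1)) t = window T (erase E1' (src_packet f1 s1')) t;
       window T (erase E2 (src_packet f2 s2)) t = window T (erase E2' (src_packet f2 s2')) t;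
       \<And>x. x < t - T \<Longrightarrow> s1 x = s1' x; \<And>x. x < t - T \<Longrightarrow> s2 x = s2' x\<rbrakk>
      \<Longrightarrow> X s1 s2 t = X s1' s2' t \<and> (T \<le> t \<longrightarrow> s1 (t - T) = s1' (t - T) \<and> s2 (t - T) = s2' (t - T))"
    and dest: "\<And>s1 s2 s1' s2' E3 E3' t.
      \<lbrakk>s1 \<in> A1; s2 \<in> A2; s1' \<in> A1; s2' \<in> A2; E3 \<in> \<E> N3; E3' \<in> \<E> N3;
       \<And>x. x \<le> t + T \<Longrightarrow> erase E3 (X s1 s2) x = erase E3' (X s1' s2') x\<rbrakk>
      \<Longrightarrow> s1 t = s1' t \<and> s2 t = s2' t"
    and "carrier F \<noteq> {}"
  shows "\<exists>g d. code_wf F n1 n2 n3 k1 k2 f1 f2 g \<and> code_achieves F k1 k2 T N1 N2 N3 f1 f2 g d"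
proof -
  obtain z where z: "z \<in> carrier F" using assms(9) by blast
  have rep: "replicate k z \<in> vecs F k" for k
    using z by (auto simp: vecs_def)
  define S where "S = A1 \<times> A2 \<times> \<E> N1 \<times> \<E> N2 \<times> (UNIV :: nat set)"
  define In where "In = (\<lambda>(s1, s2, E1, E2, t).
    (window T (erase E1 (src_packet f1 s1)) t, window T (erase E2 (src_packet f2 s2)) t,
     map (\<lambda>x. (s1 x, s2 x)) [0..<t - T]))"
  define Out where "Out = (\<lambda>(s1, s2, E1 :: nat set, E2 :: nat set, t).
    (X s1 s2 t, if T \<le> t then s1 (t - T) else replicate k1 z,
     if T \<le> t then s2 (t - T) else replicate k2 z))"
  obtain h where h: "\<And>\<sigma>. \<sigma> \<in> S \<Longrightarrow> h (In \<sigma>) = Out \<sigma>"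
      "range h \<subseteq> vecs F n3 \<times> vecs F k1 \<times> vecs F k2"
  proof (rule factor_through[of S In Out])
    show "Out ` S \<subseteq> vecs F n3 \<times> vecs F k1 \<times> vecs F k2"
      using X rep by (auto simp: Out_def S_def A1_def A2_def)
    show "(replicate n3 z, replicate k1 z, replicate k2 z) \<in> vecs F n3 \<times> vecs F k1 \<times> vecs F k2"
      using rep by simp
    fix \<sigma> \<sigma>' assume S: "\<sigma> \<in> S" "\<sigma>' \<in> S" and eq: "In \<sigma> = In \<sigma>'"
    obtain s1 s2 E1 E2 t where \<sigma>: "\<sigma> = (s1, s2, E1, E2, t)" by (cases \<sigma>) 
    obtain s1' s2' E1' E2' t' where \<sigma>': "\<sigma>' = (s1', s2', E1', E2', t')" by (cases \<sigma>')
    have w: "window T (erase E1 (src_packet f1 s1)) t = window T (erase E1' (src_packet f1 s1')) t'"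
      "window T (erase E2 (src_packet f2 s2)) t = window T (erase E2' (src_packet f2 s2')) t'"
      and m: "map (\<lambda>x. (s1 x, s2 x)) [0..<t - T] = map (\<lambda>x. (s1' x, s2' x)) [0..<t' - T]"
      using eq by (auto simp: In_def \<sigma> \<sigma>')
    \<comment> \<open>The relay is not told the time, but the lengths of its history and of its
      window together reveal \<open>t\<close>.\<close>
    have "t - T = t' - T" using arg_cong[OF m, of length] by simp
    moreover have "Suc t - (t - T) = Suc t' - (t' - T)"
      using arg_cong[OF w(1), of length] unfolding window_def by simp
    ultimately have t: "t' = t" by linarith
    have "s1 x = s1' x \<and> s2 x = s2' x" if "x < t - T" for x
      using m that unfolding t by (auto simp: map_eq_conv)
    then have "X s1 s2 t = X s1' s2' t \<and>
        (T \<le> t \<longrightarrow> s1 (t - T) = s1' (t - T) \<and> s2 (t - T) = s2' (t - T))"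
      using S w by (intro relay) (auto simp: S_def \<sigma> \<sigma>' t)
    then show "Out \<sigma> = Out \<sigma>'" by (simp add: Out_def \<sigma> \<sigma>' t)
  qed (rule that)
  define g where "g a b c = h (a, b, c)" for a b c
  have wf: "code_wf F n1 n2 n3 k1 k2 f1 f2 g"
    unfolding code_wf_def
  proof (intro conjI allI impI)
    fix a b c
    have "h (a, b, c) \<in> vecs F n3 \<times> vecs F k1 \<times> vecs F k2" using h(2) by blast
    then show "fst (g a b c) \<in> vecs F n3" "fst (snd (g a b c)) \<in> vecs F k1"
      "snd (snd (g a b c)) \<in> vecs F k2"
      by (auto simp: g_def mem_Times_iff)
  qed (use f1 f2 in auto)
  have g: "g (window T (erase E1 (src_packet f1 s1)) t) (window T (erase E2 (src_packet f2 s2)) t)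
      (map (\<lambda>x. (s1 x, s2 x)) [0..<t - T]) = (X s1 s2 t,
        if T \<le> t then s1 (t - T) else replicate k1 z, if T \<le> t then s2 (t - T) else replicate k2 z)"
    if "s1 \<in> A1" "s2 \<in> A2" "E1 \<in> \<E> N1" "E2 \<in> \<E> N2" for s1 s2 E1 E2 t
    using h(1)[of "(s1, s2, E1, E2, t)"] that by (simp add: S_def In_def Out_def g_def)
  \<comment> \<open>By induction the estimates fed back are the true messages, so \<open>g\<close>
    only meets arguments for which \<open>h\<close> was built.\<close>
  have hist: "relay_hist T g (erase E1 (src_packet f1 s1)) (erase E2 (src_packet f2 s2)) t
      = map (\<lambda>x. (s1 x, s2 x)) [0..<t - T]"
    if "s1 \<in> A1" "s2 \<in> A2" "E1 \<in> \<E> N1" "E2 \<in> \<E> N2" for s1 s2 E1 E2 t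
  proof (induction t)
    case (Suc t)
    then show ?case using g[OF that, of t] by (simp add: Suc_diff_le)
  qed simp
  have packet: "relay_packet T g (erase E1 (src_packet f1 s1)) (erase E2 (src_packet f2 s2)) = X s1 s2"
    if "s1 \<in> A1" "s2 \<in> A2" "E1 \<in> \<E> N1" "E2 \<in> \<E> N2" for s1 s2 E1 E2
    by (rule ext) (simp add: relay_packet_def hist[OF that] g[OF that])
  define S' where "S' = A1 \<times> A2 \<times> \<E> N3 \<times> (UNIV :: nat set)"
  define In' where "In' = (\<lambda>(s1, s2, E3, t). map (erase E3 (X s1 s2)) [0..<Suc (t + T)])"
  define Out' where "Out' = (\<lambda>(s1, s2, E3 :: nat set, t :: nat). (s1 t, s2 t) :: vec \<times> vec)"
  obtain d where d: "\<And>\<sigma>. \<sigma> \<in> S' \<Longrightarrow> d (In' \<sigma>) = Out' \<sigma>"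
  proof (rule factor_through[of S' In' Out' UNIV])
    fix \<sigma> \<sigma>' assume S: "\<sigma> \<in> S'" "\<sigma>' \<in> S'" and eq: "In' \<sigma> = In' \<sigma>'"
    obtain s1 s2 E3 t where \<sigma>: "\<sigma> = (s1, s2, E3, t)" by (cases \<sigma>)
    obtain s1' s2' E3' t' where \<sigma>': "\<sigma>' = (s1', s2', E3', t')" by (cases \<sigma>')
    have m: "map (erase E3 (X s1 s2)) [0..<Suc (t + T)] = map (erase E3' (X s1' s2')) [0..<Suc (t' + T)]"
      using eq unfolding In'_def \<sigma> \<sigma>' by simp
    have t: "t' = t" using arg_cong[OF m, of length] by simp
    have "erase E3 (X s1 s2) x = erase E3' (X s1' s2') x" if "x \<le> t + T" for x
      using m that unfolding t map_eq_conv by (simp del: upt_Suc)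
    then have "s1 t = s1' t \<and> s2 t = s2' t"
      using S by (intro dest[of s1 s2 s1' s2' E3 E3' t]) (auto simp: S'_def \<sigma> \<sigma>')
    then show "Out' \<sigma> = Out' \<sigma>'" by (simp add: Out'_def \<sigma> \<sigma>' t)
  qed auto
  have "code_achieves F k1 k2 T N1 N2 N3 f1 f2 g d"
    unfolding code_achieves_def Let_def
  proof (intro allI impI)
    fix s1 s2 :: "nat \<Rightarrow> vec" and E1 E2 E3 :: "nat set" and t
    assume "\<forall>t. s1 t \<in> vecs F k1" "\<forall>t. s2 t \<in> vecs F k2" "finite E1" "card E1 = N1"
      "finite E2" "card E2 = N2" "finite E3" "card E3 = N3"
    then have "s1 \<in> A1" "s2 \<in> A2" "E1 \<in> \<E> N1" "E2 \<in> \<E> N2" "E3 \<in> \<E> N3"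
      by (auto simp: A1_def A2_def \<E>_def)
    then show "d (map (erase E3 (relay_packet T g (erase E1 (src_packet f1 s1))
        (erase E2 (src_packet f2 s2)))) [0..<Suc (t + T)]) = (s1 t, s2 t)"
      using d[of "(s1, s2, E3, t)"] unfolding S'_def In'_def Out'_def by (simp add: packet)
  qed
  with wf show ?thesis by blast
qed

section \<open>Diagonal interleaving\<close>

definition symbol_at :: "vec \<Rightarrow> nat \<Rightarrow> nat" where
  "symbol_at v j = (if j < length v then v ! j else 0)"

lemma symbol_at_less: "0 < p \<Longrightarrow> v = [] \<or> v \<in> vecs (prime_field p) k \<Longrightarrow> symbol_at v j < p"
  by (auto simp: symbol_at_def vecs_def dest: nth_mem)

lemma vec_eqI:
  assumes "v \<in> vecs F k" "v' \<in> vecs F k" "\<And>j. j < k \<Longrightarrow> symbol_at v j = symbol_at v' j"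
  shows "v = v'"
  using assms by (auto simp: vecs_def symbol_at_def intro!: nth_equalityI)

text \<open>Stream \<open>c\<close> of a source is encoded diagonally by an MDS code of length \<open>len c\<close> and dimension
\<open>len c - N\<close>: position \<open>l\<close> of the codeword started at time \<open>t - l\<close> is sent at time \<open>t\<close>, and its
systematic position \<open>i\<close> carries the message symbol with index \<open>idx c i\<close>. Messages at negative times
are zero.\<close>
definition diag_symbol ::
  "nat \<Rightarrow> nat \<Rightarrow> (nat \<Rightarrow> nat) \<Rightarrow> (nat \<Rightarrow> nat \<Rightarrow> nat) \<Rightarrow> (nat \<Rightarrow> vec) \<Rightarrow> nat \<Rightarrow> nat \<Rightarrow> nat \<Rightarrow> nat" where
  "diag_symbol p N len idx s t c l = rs_code p (len c - N)
     (\<lambda>i. if l \<le> t + i then symbol_at (s (t + i - l)) (idx c i) else 0) l"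

definition diag_encoder ::
  "nat \<Rightarrow> nat \<Rightarrow> (nat \<Rightarrow> nat) \<Rightarrow> (nat \<Rightarrow> nat \<Rightarrow> nat) \<Rightarrow> (nat \<times> nat) list \<Rightarrow> vec list \<Rightarrow> vec" where
  "diag_encoder p N len idx L ms = map (\<lambda>(c, l). diag_symbol p N len idx
     (\<lambda>x. if x < length ms then ms ! x else []) (length ms - 1) c l) L"

lemma diag_encoder_vecs: "0 < p \<Longrightarrow> diag_encoder p N len idx L ms \<in> vecs (prime_field p) (length L)"
  by (auto simp: vecs_def diag_encoder_def diag_symbol_def rs_code_less)

text \<open>The message word of \<open>diag_symbol\<close> formally contains future symbols, those
  with \<open>i > l\<close>. A systematic position depends on the present symbol only, and for a
  parity position every \<open>i\<close> is below \<open>l\<close>.\<close>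

lemma diag_symbol_causal:
  assumes "prime p" "len c \<le> p"
    and s: "\<And>x. s x = [] \<or> s x \<in> vecs (prime_field p) k"
    and s': "\<And>x. s' x = [] \<or> s' x \<in> vecs (prime_field p) k"
    and eq: "\<And>x. x \<le> t \<Longrightarrow> s x = s' x"
  shows "diag_symbol p N len idx s t c l = diag_symbol p N len idx s' t c l"
proof (cases "l < len c - N")
  case True
  have "0 < p" using assms(1) prime_gt_0_nat by blast
  then show ?thesis
    unfolding diag_symbol_def using True assms(1,2) eq[of t] symbol_at_less[OF _ s] symbol_at_less[OF _ s']
    by (subst (1 2) rs_code_systematic) auto
next
  case False
  then show ?thesis
    unfolding diag_symbol_def by (intro fun_cong[OF rs_code_cong]) (auto simp: eq)
qed

lemma src_packet_diag_encoder:
  assumes "prime p" "\<And>c l. (c, l) \<in> set L \<Longrightarrow> len c \<le> p" "\<And>x. s x \<in> vecs (prime_field p) k"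
  shows "src_packet (diag_encoder p N len idx L) s t = map (\<lambda>(c, l). diag_symbol p N len idx s t c l) L"
proof -
  have "diag_symbol p N len idx (\<lambda>x. if x < Suc t then map s [0..<Suc t] ! x else []) t c l
      = diag_symbol p N len idx s t c l" if "(c, l) \<in> set L" for c l
    using assms(3) by (intro diag_symbol_causal[where len = len, OF assms(1) assms(2)[OF that]])
      (auto simp del: upt_Suc)
  then show ?thesis
    unfolding src_packet_def diag_encoder_def by (auto simp del: upt_Suc)
qed

text \<open>The codeword with this symbol at position \<open>i\<close> starts at time
  \<open>\<tau> - i\<close> and ends at \<open>\<tau> + (len c - 1 - i)\<close>. Its positions use
  distinct times, so at least \<open>len c - N\<close> of them survive.\<close>

lemma diag_symbol_recovered:
  assumes "prime p" "len c \<le> p"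
    and s: "\<And>x. s x \<in> vecs (prime_field p) k" and s': "\<And>x. s' x \<in> vecs (prime_field p) k"
    and E: "finite E" "card E \<le> N"
    and agree: "\<And>x l. x \<le> t \<Longrightarrow> x \<notin> E \<Longrightarrow> l < len c \<Longrightarrow>
      diag_symbol p N len idx s x c l = diag_symbol p N len idx s' x c l"
    and i: "i < len c - N" and \<tau>: "\<tau> + (len c - 1 - i) \<le> t"
  shows "symbol_at (s \<tau>) (idx c i) = symbol_at (s' \<tau>) (idx c i)"
proof -
  define m where "m s j = (if i \<le> \<tau> + j then symbol_at (s (\<tau> + j - i)) (idx c j) else 0)" for s j
  have p: "0 < p" using assms(1) prime_gt_0_nat by blast
  have m_less: "m s j < p" "m s' j < p" for j
    using p s s' by (auto simp: m_def intro!: symbol_at_less)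
  have diag: "diag_symbol p N len idx u (\<tau> + l - i) c l = rs_code p (len c - N) (m u) l"
    if "i \<le> \<tau> + l" for u l
    unfolding diag_symbol_def m_def using that
    by (intro fun_cong[OF rs_code_cong]) (auto intro!: arg_cong2[of _ _ _ _ symbol_at] arg_cong[of _ _ u])
  define B where "B = {l. l < len c \<and> i \<le> \<tau> + l \<and> \<tau> + l - i \<in> E}"
  define Y where "Y = {..<len c} - B"
  have B: "B \<subseteq> {..<len c}" by (auto simp: B_def)
  have "card B \<le> card E"
    by (rule card_inj_on_le[of "\<lambda>l. \<tau> + l - i"]) (auto simp: B_def inj_on_def E)
  then have cardY: "len c - N \<le> card Y"
    using card_Diff_subset[OF finite_subset[OF B] B] E(2) by (simp add: Y_def)
  have "m s i = m s' i"
  proof (rule rs_code_mds[OF assms(1) _ _ cardY _ i m_less])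
    fix l assume l: "l \<in> Y"
    show "rs_code p (len c - N) (m s) l = rs_code p (len c - N) (m s') l"
    proof (cases "i \<le> \<tau> + l")
      case True
      then have "\<tau> + l - i \<notin> E" "l < len c" using l by (auto simp: Y_def B_def)
      moreover have "\<tau> + l - i \<le> t" using \<tau> i \<open>l < len c\<close> by linarith
      ultimately show ?thesis using agree[of "\<tau> + l - i" l] diag[OF True] by simp
    next
      \<comment> \<open>Position \<open>l\<close> would be sent before time 0. As
        \<open>l < i\<close> it is systematic and carries the known value 0.\<close>
      case False
      then show ?thesis using i assms(1,2) m_less
        by (subst (1 2) rs_code_systematic) (auto simp: m_def)
    qed
  qed (use assms(2) in \<open>auto simp: Y_def\<close>)
  then show ?thesis by (simp add: m_def)
qed

text \<open>A codeword may begin before the window; its older positions are recomputed from the past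
  messages, by causality.\<close>

lemma diag_encoder_recovered:
  assumes "prime p" "\<And>c l. (c, l) \<in> set L \<Longrightarrow> len c \<le> p"
    and s: "\<And>x. s x \<in> vecs (prime_field p) k" and s': "\<And>x. s' x \<in> vecs (prime_field p) k"
    and E: "finite E" "card E = N"
    and win: "window T (erase E (src_packet (diag_encoder p N len idx L) s)) t
      = window T (erase E' (src_packet (diag_encoder p N len idx L) s')) t"
    and past: "\<And>x. x < t - T \<Longrightarrow> s x = s' x"
    and c: "\<And>l. l < len c \<Longrightarrow> (c, l) \<in> set L"
    and i: "i < len c - N" and \<tau>: "\<tau> + (len c - 1 - i) \<le> t"
  shows "symbol_at (s \<tau>) (idx c i) = symbol_at (s' \<tau>) (idx c i)"
proof -
  have "len c \<le> p" using assms(2)[OF c, of 0] i by linarith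
  then show ?thesis
  proof (rule diag_symbol_recovered[where len = len and idx = idx and c = c, OF assms(1) _ s s' E(1) eq_refl[OF E(2)] _ i \<tau>])
    fix x l assume x: "x \<le> t" "x \<notin> E" and l: "l < len c"
    show "diag_symbol p N len idx s x c l = diag_symbol p N len idx s' x c l"
    proof (cases "x < t - T")
      case True
      then show ?thesis using s s' past \<open>len c \<le> p\<close>
        by (intro diag_symbol_causal[OF assms(1)]) auto
    next
      case False
      then have "erase E (src_packet (diag_encoder p N len idx L) s) x
          = erase E' (src_packet (diag_encoder p N len idx L) s') x"
        using win x(1) unfolding window_def map_eq_conv by auto
      \<comment> \<open>Outside \<open>E\<close> the packet arrives as \<open>Some\<close>, which
        rules out an erasure by \<open>E'\<close> at this time as well.\<close>
      then have "src_packet (diag_encoder p N len idx L) s x = src_packet (diag_encoder p N len idx L) s' x"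
        using x(2) by (auto simp: erase_def split: if_splits)
      then show ?thesis
        using c[OF l] src_packet_diag_encoder[OF assms(1,2) s] src_packet_diag_encoder[OF assms(1,2) s']
        by (auto simp: map_eq_conv)
    qed
  qed
qed

section \<open>The relay scheme\<close>

text \<open>\<open>a\<close> counts the streams of source 1, \<open>Q\<close> the long and \<open>P - Q\<close> the short streams of source 2,
and \<open>b\<close> the relay codewords per source time. Relay codeword \<open>c < Q\<close> carries a long stream of
source 2, the others carry a short stream of source 2 and a stream of source 1.\<close>
locale relay_scheme =
  fixes N1 N2 N3 T a b P Q k1 k2 p :: nat
  assumes N32: "N3 \<le> N2" and N21: "N2 \<le> N1" and N13: "N1 + N3 \<le> T + 1"
    and aQ: "a + Q \<le> b" and QP: "Q \<le> P" and Pb: "P \<le> b"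
    and k1: "k1 \<le> a * (T + 1 - N3 - N1)"
    and k2: "k2 \<le> Q * (T + 1 - N3 - N2) + (P - Q) * (N1 - N2)"
    and p: "prime p" "T < p"
begin

definition w :: nat where "w = T + 1 - N3"

definition v :: nat where "v = T + 1 - N2"

definition len1 :: "nat \<Rightarrow> nat" where "len1 c = w"

definition len2 :: "nat \<Rightarrow> nat" where "len2 c = (if c < Q then w else N1)"

text \<open>Streams of source 1 are numbered from \<open>Q\<close>, so that a stream has the number
  of the relay codeword carrying it.\<close>

definition idx1 :: "nat \<Rightarrow> nat \<Rightarrow> nat" where "idx1 c i = (c - Q) * (w - N1) + i"

definition idx2 :: "nat \<Rightarrow> nat \<Rightarrow> nat" where
  "idx2 c i = (if c < Q then c * (w - N2) + i else Q * (w - N2) + (c - Q) * (N1 - N2) + i)"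

definition L1 :: "(nat \<times> nat) list" where
  "L1 = List.product [Q..<Q + a] [0..<w]"

definition L2 :: "(nat \<times> nat) list" where
  "L2 = List.product [0..<Q] [0..<w] @ List.product [Q..<P] [0..<N1]"

definition f1 :: "vec list \<Rightarrow> vec" where "f1 = diag_encoder p N1 len1 idx1 L1"

definition f2 :: "vec list \<Rightarrow> vec" where "f2 = diag_encoder p N2 len2 idx2 L2"

text \<open>The symbol of delay \<open>d\<close> in the relay codeword \<open>c\<close> for the messages of time \<open>\<tau>\<close>.\<close>
definition Z :: "(nat \<Rightarrow> vec) \<Rightarrow> (nat \<Rightarrow> vec) \<Rightarrow> nat \<Rightarrow> nat \<Rightarrow> nat \<Rightarrow> nat" where
  "Z s1 s2 \<tau> c d =
     (if c < Q \<or> d < N1 then if c < P then symbol_at (s2 \<tau>) (idx2 c (len2 c - 1 - d)) else 0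
      else if c < Q + a then symbol_at (s1 \<tau>) (idx1 c (w - 1 - d)) else 0)"

text \<open>The codeword for source time \<open>\<tau>\<close> is spread over the times
  \<open>\<tau> + N2\<close> to \<open>\<tau> + T\<close>. Its systematic position \<open>l\<close>
  holds the symbol of delay \<open>N2 + l\<close>, which reaches the relay just in time.\<close>

definition relay_symbol :: "(nat \<Rightarrow> vec) \<Rightarrow> (nat \<Rightarrow> vec) \<Rightarrow> nat \<Rightarrow> nat \<Rightarrow> nat \<Rightarrow> nat" where
  "relay_symbol s1 s2 t c l =
     (if N2 + l \<le> t then rs_code p (v - N3) (\<lambda>j. Z s1 s2 (t - N2 - l) c (N2 + j)) l else 0)"

definition X :: "(nat \<Rightarrow> vec) \<Rightarrow> (nat \<Rightarrow> vec) \<Rightarrow> nat \<Rightarrow> vec" where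
  "X s1 s2 t = map (\<lambda>(c, l). relay_symbol s1 s2 t c l) (List.product [0..<b] [0..<v])"

abbreviation A1 :: "(nat \<Rightarrow> vec) set" where "A1 \<equiv> {s. \<forall>t. s t \<in> vecs (prime_field p) k1}"

abbreviation A2 :: "(nat \<Rightarrow> vec) set" where "A2 \<equiv> {s. \<forall>t. s t \<in> vecs (prime_field p) k2}"

lemma p_pos: "0 < p"
  using p(2) by simp

text \<open>The equation \<open>v - N3 = w - N2\<close> is the exact fit: the dimension of the relay
  code is the number of delays from \<open>N2\<close> to \<open>w - 1\<close>.\<close>

lemma wv: "N1 \<le> w" "w \<le> T + 1" "v \<le> T + 1" "v - N3 = w - N2" "w - N2 \<le> p"
  using N32 N21 N13 p by (auto simp: w_def v_def)

lemma cover1: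
  assumes "j < k1"
  obtains c i where "Q \<le> c" "c < Q + a" "i < w - N1" "idx1 c i = j"
proof
  have j: "j < a * (w - N1)" using assms k1 by (simp add: w_def)
  then have pos: "0 < w - N1" by (cases "w - N1") auto
  show "Q \<le> Q + j div (w - N1)" "j mod (w - N1) < w - N1" using pos by auto
  show "Q + j div (w - N1) < Q + a"
    using j by (simp add: less_mult_imp_div_less)
  show "idx1 (Q + j div (w - N1)) (j mod (w - N1)) = j" by (simp add: idx1_def div_mult_mod_eq)
qed

lemma cover2:
  assumes "j < k2"
  obtains c i where "c < P" "i < len2 c - N2" "idx2 c i = j"
proof (cases "j < Q * (w - N2)")
  case True
  then have "0 < w - N2" by (cases "w - N2") auto
  moreover have "j div (w - N2) < Q" using True by (simp add: less_mult_imp_div_less)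
  ultimately show thesis using QP
    by (intro that[of "j div (w - N2)" "j mod (w - N2)"]) (auto simp: len2_def idx2_def div_mult_mod_eq)
next
  case False
  define j' where "j' = j - Q * (w - N2)"
  have j': "j' < (P - Q) * (N1 - N2)" "j = Q * (w - N2) + j'"
    using False assms k2 by (auto simp: j'_def w_def)
  then have pos: "0 < N1 - N2" by (cases "N1 - N2") auto
  have "j' div (N1 - N2) < P - Q" using j' by (simp add: less_mult_imp_div_less)
  then show thesis using pos j'(2)
    by (intro that[of "Q + j' div (N1 - N2)" "j' mod (N1 - N2)"]) (auto simp: len2_def idx2_def div_mult_mod_eq)
qed

lemma Z_less: "s1 \<in> A1 \<Longrightarrow> s2 \<in> A2 \<Longrightarrow> Z s1 s2 \<tau> c d < p"
  using p_pos by (auto simp: Z_def intro!: symbol_at_less)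

lemma X_vecs: "X s1 s2 t \<in> vecs (prime_field p) (b * v)"
  using p_pos by (auto simp: vecs_def X_def relay_symbol_def rs_code_less)

text \<open>Systematic position \<open>i\<close> of a stream of length \<open>m\<close> has delay
  \<open>m - 1 - i\<close>, so the systematic positions of all streams fall into delays that
  \<open>Z\<close> covers.\<close>

lemma messages_eq_if_Z_eq:
  assumes A: "s1 \<in> A1" "s2 \<in> A2" "s1' \<in> A1" "s2' \<in> A2"
    and Z: "\<And>c d. c < b \<Longrightarrow> N2 \<le> d \<Longrightarrow> d < w \<Longrightarrow> Z s1 s2 \<tau> c d = Z s1' s2' \<tau> c d"
  shows "s1 \<tau> = s1' \<tau> \<and> s2 \<tau> = s2' \<tau>"
proof
  show "s1 \<tau> = s1' \<tau>"
  proof (rule vec_eqI)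
    fix j assume "j < k1"
    then obtain c i where c: "Q \<le> c" "c < Q + a" "i < w - N1" "idx1 c i = j" by (rule cover1)
    then have "w - 1 - (w - 1 - i) = i" "N1 \<le> w - 1 - i" by auto
    then show "symbol_at (s1 \<tau>) j = symbol_at (s1' \<tau>) j"
      using Z[of c "w - 1 - i"] c aQ N21 by (auto simp: Z_def)
  qed (use A in auto)
  show "s2 \<tau> = s2' \<tau>"
  proof (rule vec_eqI)
    fix j assume "j < k2"
    then obtain c i where c: "c < P" "i < len2 c - N2" "idx2 c i = j" by (rule cover2)
    define d where "d = len2 c - 1 - i"
    have d: "len2 c - 1 - d = i" "N2 \<le> d" "d < len2 c" using c by (auto simp: d_def)
    moreover have "c < Q \<or> d < N1" "d < w" using d wv(1) by (auto simp: len2_def split: if_splits)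
    ultimately show "symbol_at (s2 \<tau>) j = symbol_at (s2' \<tau>) j"
      using Z[of c d] c Pb by (auto simp: Z_def)
  qed (use A in auto)
qed

text \<open>The last position \<open>v - 1\<close> of the codeword for time \<open>t\<close> is sent
  at \<open>t + T\<close>, exactly at the deadline, and \<open>N3\<close> erasures leave enough
  positions for the MDS code.\<close>

lemma destination_decodes:
  assumes A: "s1 \<in> A1" "s2 \<in> A2" "s1' \<in> A1" "s2' \<in> A2"
    and E: "finite E" "card E = N3"
    and eq: "\<And>x. x \<le> t + T \<Longrightarrow> erase E (X s1 s2) x = erase E' (X s1' s2') x"
  shows "s1 t = s1' t \<and> s2 t = s2' t"
proof (rule messages_eq_if_Z_eq[OF A])
  fix c d assume c: "c < b" and d: "N2 \<le> d" "d < w"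
  define B where "B = {l. l < v \<and> t + N2 + l \<in> E}"
  define Y where "Y = {..<v} - B"
  have B: "B \<subseteq> {..<v}" by (auto simp: B_def)
  have "card B \<le> card E"
    by (rule card_inj_on_le[of "\<lambda>l. t + N2 + l"]) (auto simp: B_def inj_on_def E)
  then have Y: "v - N3 \<le> card Y"
    using card_Diff_subset[OF finite_subset[OF B] B] E(2) by (simp add: Y_def)
  have "Z s1 s2 t c (N2 + (d - N2)) = Z s1' s2' t c (N2 + (d - N2))"
  proof (rule rs_code_mds[where m = "\<lambda>j. Z s1 s2 t c (N2 + j)" and m' = "\<lambda>j. Z s1' s2' t c (N2 + j)",
        OF p(1) _ _ Y])
    fix l assume l: "l \<in> Y"
    then have lv: "l < v" "t + N2 + l \<notin> E" by (auto simp: Y_def B_def)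
    then have "t + N2 + l \<le> t + T" by (simp add: v_def)
    from eq[OF this] have "X s1 s2 (t + N2 + l) = X s1' s2' (t + N2 + l)"
      using lv(2) by (auto simp: erase_def split: if_splits)
    then have "relay_symbol s1 s2 (t + N2 + l) c l = relay_symbol s1' s2' (t + N2 + l) c l"
      using c lv(1) by (auto simp: X_def map_eq_conv)
    then show "rs_code p (v - N3) (\<lambda>j. Z s1 s2 t c (N2 + j)) l
        = rs_code p (v - N3) (\<lambda>j. Z s1' s2' t c (N2 + j)) l"
      by (simp add: relay_symbol_def)
  qed (use wv d A Z_less p(2) in \<open>auto simp: Y_def\<close>)
  then show "Z s1 s2 t c d = Z s1' s2' t c d" using d by simp
qed

text \<open>When position \<open>l\<close> is due, a systematic symbol has just arrived; a parity
  position has \<open>v - N3 \<le> l\<close>, so it combines only symbols of delay below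
  \<open>N2 + l\<close>.\<close>

lemma relay_decodes:
  assumes A: "s1 \<in> A1" "s2 \<in> A2" "s1' \<in> A1" "s2' \<in> A2"
    and E1: "finite E1" "card E1 = N1" and E2: "finite E2" "card E2 = N2"
    and w1: "window T (erase E1 (src_packet f1 s1)) t = window T (erase E1' (src_packet f1 s1')) t"
    and w2: "window T (erase E2 (src_packet f2 s2)) t = window T (erase E2' (src_packet f2 s2')) t"
    and past: "\<And>x. x < t - T \<Longrightarrow> s1 x = s1' x" "\<And>x. x < t - T \<Longrightarrow> s2 x = s2' x"
  shows "X s1 s2 t = X s1' s2' t \<and> (T \<le> t \<longrightarrow> s1 (t - T) = s1' (t - T) \<and> s2 (t - T) = s2' (t - T))"
proof -
  have 1: "symbol_at (s1 \<tau>) (idx1 c i) = symbol_at (s1' \<tau>) (idx1 c i)"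
    if "Q \<le> c" "c < Q + a" "i < w - N1" "\<tau> + (w - 1 - i) \<le> t" for \<tau> c i
    by (rule diag_encoder_recovered[where len = len1 and L = L1, OF p(1) _ _ _ E1 w1[unfolded f1_def] past(1)])
      (use A that wv(2) p(2) in \<open>auto simp: len1_def L1_def\<close>)
  have 2: "symbol_at (s2 \<tau>) (idx2 c i) = symbol_at (s2' \<tau>) (idx2 c i)"
    if "c < P" "i < len2 c - N2" "\<tau> + (len2 c - 1 - i) \<le> t" for \<tau> c i
    by (rule diag_encoder_recovered[where len = len2 and L = L2, OF p(1) _ _ _ E2 w2[unfolded f2_def] past(2)])
      (use A that wv(1,2) p(2) in \<open>auto simp: len2_def L2_def split: if_splits\<close>)
  have Z: "Z s1 s2 \<tau> c d = Z s1' s2' \<tau> c d" if d: "N2 \<le> d" "d < w" "\<tau> + d \<le> t" for \<tau> c d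
  proof (cases "c < Q \<or> d < N1")
    case True
    then have "d < len2 c" using d by (auto simp: len2_def)
    then have "len2 c - 1 - (len2 c - 1 - d) = d" "len2 c - 1 - d < len2 c - N2"
      using d by auto
    then show ?thesis using True d 2[of c "len2 c - 1 - d" \<tau>] by (auto simp: Z_def)
  next
    case False
    then have "w - 1 - (w - 1 - d) = d" "w - 1 - d < w - N1" using d by auto
    then show ?thesis using False d 1[of c "w - 1 - d" \<tau>] by (auto simp: Z_def)
  qed
  have "relay_symbol s1 s2 t c l = relay_symbol s1' s2' t c l" if "l < v" for c l
  proof (cases "N2 + l \<le> t")
    case True
    note t = True
    show ?thesis
    proof (cases "l < v - N3")
      case True
      then have "Z s1 s2 (t - N2 - l) c (N2 + l) = Z s1' s2' (t - N2 - l) c (N2 + l)"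
        using t wv(4) by (intro Z) auto
      then show ?thesis
        using True t Z_less A wv p unfolding relay_symbol_def
        by (simp add: rs_code_systematic)
    next
      case False
      then show ?thesis
        using t wv(4) unfolding relay_symbol_def
        by (auto intro!: fun_cong[OF rs_code_cong] Z)
    qed
  qed (simp add: relay_symbol_def)
  then have "X s1 s2 t = X s1' s2' t" by (auto simp: X_def)
  \<comment> \<open>All delays are below \<open>w\<close>, hence at most \<open>T\<close>, so the
    messages of time \<open>t - T\<close> are complete at time \<open>t\<close>.\<close>
  moreover have "s1 (t - T) = s1' (t - T) \<and> s2 (t - T) = s2' (t - T)" if "T \<le> t"
    using wv(2) that by (intro messages_eq_if_Z_eq[OF A] Z) auto
  ultimately show ?thesis by blast
qed

lemma code_exists:
  "\<exists>f1 f2 g d. code_wf (prime_field p) (a * w) (Q * w + (P - Q) * N1) (b * v) k1 k2 f1 f2 g \<and>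
     code_achieves (prime_field p) k1 k2 T N1 N2 N3 f1 f2 g d"
proof -
  have "\<exists>g d. code_wf (prime_field p) (a * w) (Q * w + (P - Q) * N1) (b * v) k1 k2 f1 f2 g \<and>
     code_achieves (prime_field p) k1 k2 T N1 N2 N3 f1 f2 g d"
  proof (rule code_exists_if_determined[where X = X])
    show "f1 ms \<in> vecs (prime_field p) (a * w)" for ms
      using diag_encoder_vecs[OF p_pos, of N1 len1 idx1 L1 ms] by (simp add: f1_def L1_def)
    show "f2 ms \<in> vecs (prime_field p) (Q * w + (P - Q) * N1)" for ms
      using diag_encoder_vecs[OF p_pos, of N2 len2 idx2 L2 ms] by (simp add: f2_def L2_def)
    show "carrier (prime_field p) \<noteq> {}" using p_pos by auto
  next
    fix s1 s2 s1' s2' E1 E2 E1' E2' t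
    assume "s1 \<in> A1" "s2 \<in> A2" "s1' \<in> A1" "s2' \<in> A2"
      and E: "E1 \<in> {E. finite E \<and> card E = N1}" "E2 \<in> {E. finite E \<and> card E = N2}"
      and "window T (erase E1 (src_packet f1 s1)) t = window T (erase E1' (src_packet f1 s1')) t"
        "window T (erase E2 (src_packet f2 s2)) t = window T (erase E2' (src_packet f2 s2')) t"
        "\<And>x. x < t - T \<Longrightarrow> s1 x = s1' x" "\<And>x. x < t - T \<Longrightarrow> s2 x = s2' x"
    then show "X s1 s2 t = X s1' s2' t \<and>
        (T \<le> t \<longrightarrow> s1 (t - T) = s1' (t - T) \<and> s2 (t - T) = s2' (t - T))"
      by (intro relay_decodes[of s1 s2 s1' s2' E1 E2 t E1' E2']) simp_all
  next
    fix s1 s2 s1' s2' E3 E3' t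
    assume "s1 \<in> A1" "s2 \<in> A2" "s1' \<in> A1" "s2' \<in> A2"
      and "E3 \<in> {E. finite E \<and> card E = N3}"
      and "\<And>x. x \<le> t + T \<Longrightarrow> erase E3 (X s1 s2) x = erase E3' (X s1' s2') x"
    then show "s1 t = s1' t \<and> s2 t = s2' t"
      by (intro destination_decodes[of s1 s2 s1' s2' E3 t E3']) simp_all
  qed (rule X_vecs)
  then show ?thesis by blast
qed

end

section \<open>Time sharing\<close>

lemma common_denominator:
  fixes S :: "real set"
  assumes "finite S" "S \<subseteq> \<rat> \<inter> {0..}"
  shows "\<exists>D>0. \<forall>x\<in>S. \<exists>n. x * real D = real n"
  using assms
proof (induction S rule: finite_induct)
  case empty
  then show ?case by auto
next
  case (insert y S)
  then obtain D where D: "D > 0" "\<forall>x\<in>S. \<exists>n. x * real D = real n" by auto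
  have "y \<in> \<rat>" "0 \<le> y" using insert.prems by auto
  then obtain m n :: nat where y: "n \<noteq> 0" "y = real m / real n"
    using Rats_abs_nat_div_natE[of y] by (metis abs_of_nonneg)
  have "\<exists>k. x * real (D * n) = real k" if x: "x \<in> S" for x
  proof -
    obtain k where "x * real D = real k" using D x by blast
    then have "x * real (D * n) = real (k * n)" by simp
    then show ?thesis by blast
  qed
  moreover have "y * real (D * n) = real (m * D)" using y by simp
  ultimately have "\<forall>x\<in>insert y S. \<exists>k. x * real (D * n) = real k" by blast
  then show ?case using D(1) y(1) by (intro exI[of _ "D * n"]) simp
qed

text \<open>Scaling by the packet size turns the shares into the counts of
  \<open>relay_scheme\<close>. The bounds with \<open>W\<close> are the packet sizes of the sources,
  those with \<open>V\<close> the number of relay codewords.\<close>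

lemma rate_pair_achievable_if_shares:
  fixes N1 N2 N3 T :: nat and \<alpha> \<pi> \<kappa> R1 R2 :: real
  defines "W \<equiv> real T + 1 - real N3" and "V \<equiv> real T + 1 - real N2"
  assumes N: "N3 \<le> N2" "N2 \<le> N1" "N1 + N3 \<le> T + 1" "N2 \<le> T"
    and rat: "{\<alpha>, \<pi>, \<kappa>, R1, R2} \<subseteq> \<rat> \<inter> {0..}"
    and le: "\<kappa> \<le> \<pi>" "\<alpha> * W \<le> 1" "real N1 * \<pi> + (W - real N1) * \<kappa> \<le> 1"
      "(\<alpha> + \<kappa>) * V \<le> 1" "\<pi> * V \<le> 1"
    and R: "R1 \<le> \<alpha> * (W - real N1)" "R2 \<le> (real N1 - real N2) * \<pi> + (W - real N1) * \<kappa>"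
  shows "rate_pair_achievable N1 N2 N3 T R1 R2"
proof -
  define w where "w = T + 1 - N3"
  define v where "v = T + 1 - N2"
  have W: "W = real w" and V: "V = real v" and v: "0 < v" and w: "N1 \<le> w"
    using N by (auto simp: W_def V_def w_def v_def)
  have "finite {\<alpha>, \<pi>, \<kappa>, R1, R2}" by simp
  from common_denominator[OF this rat] obtain b
    where b: "0 < b" and nat: "\<forall>x\<in>{\<alpha>, \<pi>, \<kappa>, R1, R2}. \<exists>n. x * real b = real n"
    by (elim exE conjE)
  \<comment> \<open>The relay packet sets the size: \<open>b\<close> codewords of \<open>v\<close>
    symbols. As \<open>b\<close> is a common denominator, all scaled shares are natural
    numbers.\<close>
  define n where "n = b * v"
  have n: "0 < n" "real n = real b * real v" using b v by (auto simp: n_def)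
  have nat': "\<exists>m. x * real n = real m" if "x \<in> {\<alpha>, \<pi>, \<kappa>, R1, R2}" for x
  proof -
    from bspec[OF nat that] obtain m where "x * real b = real m" by blast
    then have "x * real n = real (m * v)" by (simp add: n)
    then show ?thesis by blast
  qed
  obtain a P Q k1 k2 :: nat where nats: "\<alpha> * real n = real a" "\<pi> * real n = real P"
      "\<kappa> * real n = real Q" "R1 * real n = real k1" "R2 * real n = real k2"
    using nat'[of \<alpha>] nat'[of \<pi>] nat'[of \<kappa>] nat'[of R1] nat'[of R2] by auto
  have scale: "x * real n \<le> y * real n" if "x \<le> y" for x y
    using that by (simp add: mult_right_mono)
  have QP: "Q \<le> P" using scale[OF le(1)] nats by simp
  have aw: "a * w \<le> n"
  proof -
    have "real a * real w \<le> real n"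
      using scale[OF le(2)] unfolding W nats[symmetric] by (simp add: algebra_simps)
    then show ?thesis by (simp only: of_nat_mult[symmetric] of_nat_le_iff)
  qed
  have "real N1 * real P + (real w - real N1) * real Q \<le> real n"
    using scale[OF le(3)] unfolding W nats[symmetric] by (simp add: algebra_simps)
  also have "real N1 * real P + (real w - real N1) * real Q = real (Q * w + (P - Q) * N1)"
    by (simp only: of_nat_add of_nat_mult of_nat_diff[OF QP]) (simp add: algebra_simps)
  finally have Qw: "Q * w + (P - Q) * N1 \<le> n" by (simp only: of_nat_le_iff)
  have aQ: "a + Q \<le> b"
  proof -
    have "real (a + Q) * real v \<le> real b * real v"
      using scale[OF le(4)] unfolding V of_nat_add nats[symmetric] n(2)[symmetric]
      by (simp add: algebra_simps)
    then show ?thesis using v by simp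
  qed
  have Pb: "P \<le> b"
  proof -
    have "real P * real v \<le> real b * real v"
      using scale[OF le(5)] unfolding V nats[symmetric] n(2)[symmetric]
      by (simp add: algebra_simps)
    then show ?thesis using v by simp
  qed
  have k1: "k1 \<le> a * (w - N1)"
  proof -
    have "real k1 \<le> real a * (real w - real N1)"
      using scale[OF R(1)] unfolding W nats[symmetric] by (simp add: algebra_simps)
    also have "\<dots> = real (a * (w - N1))" using w by (simp add: of_nat_diff)
    finally show ?thesis by (simp only: of_nat_le_iff)
  qed
  have k2: "k2 \<le> Q * (w - N2) + (P - Q) * (N1 - N2)"
  proof -
    have "real k2 \<le> (real N1 - real N2) * real P + (real w - real N1) * real Q"
      using scale[OF R(2)] unfolding W nats[symmetric] by (simp add: algebra_simps)
    also have "\<dots> = real (Q * (w - N2) + (P - Q) * (N1 - N2))"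
      by (simp only: of_nat_add of_nat_mult of_nat_diff[OF QP] of_nat_diff[OF N(2)]
          of_nat_diff[OF order_trans[OF N(2) w]]) (simp add: algebra_simps)
    finally show ?thesis by (simp only: of_nat_le_iff)
  qed
  \<comment> \<open>All codes have length at most \<open>T + 1\<close>, so \<open>p > T\<close>
    provides enough evaluation points.\<close>
  obtain p where p: "prime p" "T < p" using bigger_prime[of T] by blast
  interpret scheme: relay_scheme N1 N2 N3 T a b P Q k1 k2 p
    by (rule relay_scheme.intro[OF N(1-3) aQ QP Pb k1[unfolded w_def] k2[unfolded w_def] p])
  have "scheme.w = w" "scheme.v = v"
    unfolding w_def v_def scheme.w_def scheme.v_def by (rule refl)+
  then obtain f1 f2 g d where
      code: "code_wf (prime_field p) (a * w) (Q * w + (P - Q) * N1) (b * v) k1 k2 f1 f2 g"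
        "code_achieves (prime_field p) k1 k2 T N1 N2 N3 f1 f2 g d"
    using scheme.code_exists by auto
  have max: "max (a * w) (max (Q * w + (P - Q) * N1) (b * v)) = n"
    using aw Qw by (simp add: n_def)
  have rates: "R1 = real k1 / real n" "R2 = real k2 / real n"
    using nats(4,5) n(1) by (simp_all add: eq_divide_eq)
  show ?thesis
    unfolding rate_pair_achievable_def
  proof (intro exI conjI)
    show "field (prime_field p)" by (rule field_prime_field[OF p(1)])
    show "finite (carrier (prime_field p))" by simp
    show "0 < max (a * w) (max (Q * w + (P - Q) * N1) (b * v))" unfolding max by (rule n(1))
    show "R1 = real k1 / real (max (a * w) (max (Q * w + (P - Q) * N1) (b * v)))"
      "R2 = real k2 / real (max (a * w) (max (Q * w + (P - Q) * N1) (b * v)))"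
      unfolding max by (rule rates)+
  qed (rule code)+
qed

text \<open>With packet size normalised to 1, \<open>\<alpha>\<close>, \<open>\<pi>\<close> and \<open>\<kappa>\<close> stand for \<open>a\<close>, \<open>P\<close> and \<open>Q\<close>. The first case
of the proof meets the sum-rate bound, the second the single-user bound of source 2, and the third
solves for equality in the packet size of source 2 and in the relay constraint \<open>\<alpha> + \<kappa> \<le> 1 / V\<close>.\<close>
lemma shares_exist:
  fixes n1 n2 n3 V R1 R2 :: real
  defines "W \<equiv> V + n2 - n3"
  assumes n: "0 \<le> n3" "n3 \<le> n2" "n2 \<le> n1" "0 < n2"
    and V: "0 < V" "n2 - n3 \<le> V" and W: "n1 \<le> W"
    and rat: "{n1, n2, n3, V, R1} \<subseteq> \<rat>"
    and R1: "0 \<le> R1" "R1 \<le> (W - n1) / W"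
    and R2: "R2 \<le> (W - n2) / W" "R2 \<le> (V - n3) / V - (W - n1) / W"
      "R2 \<le> n2 / n1 * (n1 / n2 - 1 - R1 + (W - n1) / V)"
  shows "\<exists>\<alpha> \<pi> \<kappa>. {\<alpha>, \<pi>, \<kappa>} \<subseteq> \<rat> \<inter> {0..} \<and> \<kappa> \<le> \<pi> \<and> \<alpha> * W \<le> 1 \<and>
     n1 * \<pi> + (W - n1) * \<kappa> \<le> 1 \<and> (\<alpha> + \<kappa>) * V \<le> 1 \<and> \<pi> * V \<le> 1 \<and>
     R1 \<le> \<alpha> * (W - n1) \<and> R2 \<le> (n1 - n2) * \<pi> + (W - n1) * \<kappa>"
proof -
  have VW: "V \<le> W" "0 < W" "W \<in> \<rat>" using n V rat by (auto simp: W_def)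
  have inv: "1 / W \<le> 1 / V" using VW V by (simp add: frac_le)
  have D: "W / V - 1 = (n2 - n3) / V" using V by (simp add: W_def field_simps)
  consider "(n2 - n3) / V \<le> (W - n1) / W"
    | "(W - n1) / W < (n2 - n3) / V" "R1 \<le> (1 / V - 1 / W) * (W - n1)"
    | "(W - n1) / W < (n2 - n3) / V" "(1 / V - 1 / W) * (W - n1) < R1"
    by linarith
  then show ?thesis
  proof cases
    \<comment> \<open>Source 1 fills its packet, every relay codeword carries a stream of source 2,
      and \<kappa> is what \<alpha> leaves. The case condition says that the packet of source 2
      suffices.\<close>
    case 1
    have "n1 * (1 / V) + (W - n1) * (1 / V - 1 / W) = W / V - (W - n1) / W"
      using V VW by (simp add: field_simps)
    also have "\<dots> \<le> 1" using 1 D by linarith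
    finally have "n1 * (1 / V) + (W - n1) * (1 / V - 1 / W) \<le> 1" .
    moreover have "(n1 - n2) * (1 / V) + (W - n1) * (1 / V - 1 / W) = (W - n2) / V - (W - n1) / W"
      using V VW by (simp add: field_simps)
    moreover have "W - n2 = V - n3" by (simp add: W_def)
    ultimately show ?thesis
      using V VW inv rat R1 R2(2)
      by (intro exI[of _ "1 / W"] exI[of _ "1 / V"] exI[of _ "1 / V - 1 / W"]) auto
  next
    \<comment> \<open>Source 2 fills its packet with long streams only; the rest of the relay
      codewords suffices for \<open>R1\<close>.\<close>
    case 2
    have "(n1 - n2) * (1 / W) + (W - n1) * (1 / W) = (W - n2) / W"
      "n1 * (1 / W) + (W - n1) * (1 / W) = 1" using VW by (auto simp: field_simps)
    moreover have "(1 / V - 1 / W) * W \<le> 1"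
    proof -
      have "(1 / V - 1 / W) * W = (n2 - n3) / V" using D VW by (simp add: left_diff_distrib)
      then show ?thesis using V by simp
    qed
    ultimately show ?thesis
      using V VW inv rat R2(1) 2
      by (intro exI[of _ "1 / V - 1 / W"] exI[of _ "1 / W"] exI[of _ "1 / W"]) auto
  next
    case 3
    have n1: "0 < n1" using n by linarith
    have Wn1: "0 < W - n1"
    proof (rule ccontr)
      assume "\<not> 0 < W - n1"
      then have "W = n1" using W by simp
      then show False using 3(2) R1 by simp
    qed
    \<comment> \<open>The share \<alpha> is just enough for \<open>R1\<close>; the other two follow
      from the two equalities.\<close>
    define \<alpha> where "\<alpha> = R1 / (W - n1)"
    define \<kappa> where "\<kappa> = 1 / V - \<alpha>"
    define \<pi> where "\<pi> = (1 - (W - n1) * \<kappa>) / n1"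
    have \<alpha>: "0 \<le> \<alpha>" "\<alpha> * (W - n1) = R1" "1 / V - 1 / W < \<alpha>" "\<alpha> \<le> 1 / W"
      using Wn1 R1 3(2) VW by (auto simp: \<alpha>_def pos_less_divide_eq pos_divide_le_eq)
    have \<kappa>: "0 \<le> \<kappa>" "\<kappa> \<le> 1 / W" using \<alpha> inv by (auto simp: \<kappa>_def)
    have "(W - n1) * \<kappa> \<le> (W - n1) * (1 / W)" using \<kappa> Wn1 by (intro mult_left_mono) auto
    also have "\<dots> = 1 - n1 * (1 / W)" using VW by (simp add: field_simps)
    finally have "1 / W \<le> \<pi>" using n1 by (simp add: \<pi>_def pos_le_divide_eq mult.commute)
    then have \<kappa>\<pi>: "\<kappa> \<le> \<pi>" using \<kappa> by simp
    have Wk: "(W - n1) * \<kappa> = (W - n1) / V - R1"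
      unfolding \<kappa>_def right_diff_distrib using \<alpha>(2) by (simp add: mult.commute)
    have \<pi>: "n1 * \<pi> = 1 - (W - n1) * \<kappa>" using n1 by (simp add: \<pi>_def)
    have "n1 * (\<pi> * V) = V - (W - n1) + R1 * V"
      unfolding mult.assoc[symmetric] \<pi> Wk using V by (simp add: field_simps)
    \<comment> \<open>By definition of \<open>W\<close>, this inequality is what
      \<open>\<pi> * V \<le> 1\<close> amounts to.\<close>
    also have "R1 * V \<le> n2 - n3"
      using R1(2) 3(1) V by (simp add: pos_less_divide_eq[symmetric] pos_le_divide_eq[symmetric])
    finally have "n1 * (\<pi> * V) \<le> n1 * 1" by (simp add: W_def)
    then have "\<pi> * V \<le> 1" using n1 mult_le_cancel_left_pos by blast
    moreover have "(n1 - n2) * \<pi> + (W - n1) * \<kappa> = 1 - n2 * \<pi>"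
      using \<pi> by (simp add: algebra_simps)
    moreover have "1 - n2 * \<pi> = n2 / n1 * (n1 / n2 - 1 - R1 + (W - n1) / V)"
      unfolding \<pi>_def Wk using n1 n(4) by (simp add: field_simps)
    moreover have "\<alpha> * W \<le> 1" using \<alpha>(4) VW by (simp add: pos_le_divide_eq)
    moreover have "\<alpha> \<in> \<rat>" using rat VW by (auto simp: \<alpha>_def)
    moreover from this have "\<kappa> \<in> \<rat>" using rat by (auto simp: \<kappa>_def)
    moreover from this have "\<pi> \<in> \<rat>" using rat VW by (auto simp: \<pi>_def)
    ultimately show ?thesis
      using \<alpha> \<kappa> \<kappa>\<pi> \<pi> R2(3) V
      by (intro exI[of _ \<alpha>] exI[of _ \<pi>] exI[of _ \<kappa>]) (auto simp: \<kappa>_def)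
  qed
qed

text \<open>The bound puts \<open>V\<close> at or beyond the larger root of
  \<open>x\<^sup>2 - n1 * x + n3 * (n2 - n3)\<close>. Replacing \<open>n2\<close> by
  \<open>n1\<close> makes the quadratic factor with roots \<open>n3\<close> and
  \<open>n1 - n3\<close>; since \<open>n1 \<le> 2 * V\<close>, both lie at or below
  \<open>V\<close>.\<close>

lemma delay_bound_consequences:
  fixes n1 n2 n3 V :: real
  assumes n: "0 \<le> n3" "n3 \<le> n2" "n2 \<le> n1"
    and V: "sqrt (n1\<^sup>2 - 4 * n3 * (n2 - n3)) + n1 \<le> 2 * V"
  shows "n1 \<le> 2 * V" "n1 - n3 \<le> V" "n3 \<le> V"
proof -
  have "4 * (n3 * (n2 - n3)) = n2\<^sup>2 - (n2 - 2 * n3)\<^sup>2"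
    by (simp add: power2_eq_square algebra_simps)
  also have "\<dots> \<le> n1\<^sup>2" using n power_mono[of n2 n1 2] zero_le_power2[of "n2 - 2 * n3"] by linarith
  finally have disc: "0 \<le> n1\<^sup>2 - 4 * n3 * (n2 - n3)" by simp
  then show n1: "n1 \<le> 2 * V" using V real_sqrt_ge_zero[OF disc] by linarith
  have "n1\<^sup>2 - 4 * n3 * (n2 - n3) \<le> (2 * V - n1)\<^sup>2"
    using V disc by (intro sqrt_le_D) linarith
  then have "V * (n1 - V) \<le> n3 * (n2 - n3)" by (simp add: power2_eq_square algebra_simps)
  also have "\<dots> \<le> n3 * (n1 - n3)" using n by (intro mult_left_mono) auto
  finally have "V * (n1 - V) - n3 * (n1 - n3) \<le> 0" by simp
  moreover have "V * (n1 - V) - n3 * (n1 - n3) = (n1 - n3 - V) * (V - n3)"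
    by (simp add: algebra_simps)
  ultimately have prod: "(n1 - n3 - V) * (V - n3) \<le> 0" by simp
  show "n1 - n3 \<le> V"
  proof (rule ccontr)
    assume "\<not> n1 - n3 \<le> V"
    then show False using prod n1 mult_pos_pos[of "n1 - n3 - V" "V - n3"] by linarith
  qed
  show "n3 \<le> V"
  proof (rule ccontr)
    assume "\<not> n3 \<le> V"
    then show False using prod n1 mult_neg_neg[of "n1 - n3 - V" "V - n3"] by linarith
  qed
qed

theorem theorem2:
  fixes N1 N2 N3 T :: nat and R1 :: real
  assumes "N1 \<ge> N2" and "N2 \<ge> N3"
    and "real T \<ge> (sqrt ((real N1)^2 - 4 * real N3 * (real N2 - real N3))
                     + real N1 + 2 * real N2 - 2) / 2"
    and "R1 \<in> \<rat>" and "0 \<le> R1" and "R1 \<le> capC (real T - real N3) (real N1)"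
  shows "rate_pair_achievable N1 N2 N3 T R1
           (min (capC (real T - real N3) (real N2))
             (min (capC (real T - real N2) (real N3) - capC (real T - real N3) (real N1))
                  (real N2 / real N1 * (real N1 / real N2 - 1 - R1
                     + (real T + 1 - real N1 - real N3) / (real T + 1 - real N2)))))"
    (is "rate_pair_achievable N1 N2 N3 T R1 ?R2")
proof -
  define V where "V = real T + 1 - real N2"
  define W where "W = V + real N2 - real N3"
  have W': "real T + 1 - real N3 = W" by (simp add: W_def V_def)
  have n: "0 \<le> real N3" "real N3 \<le> real N2" "real N2 \<le> real N1" using assms by auto
  note delay = delay_bound_consequences[OF n, of V]
  have "sqrt ((real N1)\<^sup>2 - 4 * real N3 * (real N2 - real N3)) + real N1 \<le> 2 * V"
    using assms(3) by (simp add: V_def field_simps)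
  note delay = delay[OF this]
  \<comment> \<open>For \<open>N1 = 0\<close> the delay bound only gives \<open>0 \<le> V\<close>,
    but then \<open>N2 = 0\<close> and \<open>V = T + 1\<close>.\<close>
  have V: "0 < V"
    using delay(1) n by (cases "N1 = 0") (auto simp: V_def)
  have W: "0 < W" "V \<le> W" using V n by (auto simp: W_def)
  have cap: "capC (real T - real N3) (real N) = (W - real N) / W" for N
    by (simp add: capC_def W_def V_def algebra_simps)
  have cap2: "capC (real T - real N2) (real N3) = (V - real N3) / V"
    by (simp add: capC_def V_def algebra_simps)
  define R2 where "R2 = ?R2"
  have R2: "R2 = min ((W - real N2) / W) (min ((V - real N3) / V - (W - real N1) / W)
      (real N2 / real N1 * (real N1 / real N2 - 1 - R1 + (W - real N1) / V)))"
    unfolding R2_def cap cap2 by (simp add: W_def V_def algebra_simps)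
  have R1: "R1 \<le> (W - real N1) / W" using assms(6) unfolding cap .
  \<comment> \<open>A rate \<open>R1\<close> exists in the given interval only if
    \<open>N1 \<le> W\<close>.\<close>
  then have "0 \<le> (W - real N1) / W" using assms(5) by linarith
  then have W1: "real N1 \<le> W" using W by (simp add: zero_le_divide_iff)
  have VR: "V \<in> \<rat>" "W \<in> \<rat>" by (auto simp: V_def W_def)
  \<comment> \<open>\<open>R2\<close> must be nonnegative to be realised by a natural number
    \<open>k2\<close>.\<close>
  have R2_nonneg: "0 \<le> R2" unfolding R2
  proof (intro min.boundedI)
    show "0 \<le> (W - real N2) / W" using W W1 n by simp
    have "real N3 * (real N2 - real N3) \<le> V * (real N1 - real N3)"
      using delay(3) n by (intro mult_mono) auto
    then have "0 \<le> V * real N1 - W * real N3" by (simp add: W_def algebra_simps)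
    moreover have "(V - real N3) / V - (W - real N1) / W = (V * real N1 - W * real N3) / (V * W)"
      using V W by (simp add: field_simps)
    ultimately show "0 \<le> (V - real N3) / V - (W - real N1) / W" using V W by simp
    show "0 \<le> real N2 / real N1 * (real N1 / real N2 - 1 - R1 + (W - real N1) / V)"
    proof (cases "N2 = 0")
      case False
      have "(W - real N1) / W \<le> (W - real N1) / V" using V W W1 by (intro divide_left_mono) auto
      moreover have "1 \<le> real N1 / real N2" using n False by simp
      ultimately show ?thesis using R1 by (intro mult_nonneg_nonneg) auto
    qed simp
  qed
  have R2_rat: "R2 \<in> \<rat>"
    unfolding R2 using VR assms(4) by (auto simp: min_def)
  have "\<exists>\<alpha> \<pi> \<kappa>. {\<alpha>, \<pi>, \<kappa>} \<subseteq> \<rat> \<inter> {0..} \<and> \<kappa> \<le> \<pi> \<and> \<alpha> * W \<le> 1 \<and>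
     real N1 * \<pi> + (W - real N1) * \<kappa> \<le> 1 \<and> (\<alpha> + \<kappa>) * V \<le> 1 \<and> \<pi> * V \<le> 1 \<and>
     R1 \<le> \<alpha> * (W - real N1) \<and> R2 \<le> (real N1 - real N2) * \<pi> + (W - real N1) * \<kappa>"
  proof (cases "N2 = 0")
    \<comment> \<open>The factor \<open>N2 / N1\<close> is 0, so \<open>R2\<close> is at most 0 and
      source 2 can stay silent.\<close>
    case True
    then have "R2 \<le> 0" by (simp add: R2)
    then show ?thesis using W V R1 VR
      by (intro exI[of _ "1 / W"] exI[of _ 0]) auto
  next
    case False
    have "R2 \<le> (W - real N2) / W" "R2 \<le> (V - real N3) / V - (W - real N1) / W"
      "R2 \<le> real N2 / real N1 * (real N1 / real N2 - 1 - R1 + (W - real N1) / V)"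
      unfolding R2 by (auto simp: min_le_iff_disj)
    then show ?thesis
      unfolding W_def using False n V delay(2) VR assms(4,5) W1 R1
      by (intro shares_exist) (auto simp: W_def)
  qed
  then obtain \<alpha> \<pi> \<kappa> where "{\<alpha>, \<pi>, \<kappa>} \<subseteq> \<rat> \<inter> {0..}" "\<kappa> \<le> \<pi>" "\<alpha> * W \<le> 1"
     "real N1 * \<pi> + (W - real N1) * \<kappa> \<le> 1" "(\<alpha> + \<kappa>) * V \<le> 1" "\<pi> * V \<le> 1"
     "R1 \<le> \<alpha> * (W - real N1)" "R2 \<le> (real N1 - real N2) * \<pi> + (W - real N1) * \<kappa>"
    by (elim exE conjE)
  moreover have "N1 + N3 \<le> T + 1" "N2 \<le> T"
    using W1 V by (simp_all add: W_def V_def)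
  ultimately show ?thesis
    unfolding R2_def[symmetric] using assms(1,2,4,5) R2_rat R2_nonneg
    by (intro rate_pair_achievable_if_shares[of N3 N2 N1 T \<alpha> \<pi> \<kappa>]) (simp_all add: W' V_def[symmetric])
qed

end
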